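(* Let $0<q<1$. For fixed $z\in\mathbb{C}_q$ and every $\xi\in\mathcal{I}_q$, the wave function of the coherent state corresponding to the level $m=0$, that is, $\langle\xi|z,0,q\rangle=(\mathcal{N}_{0,q}(z\bar z))^{-1/2}\sum_{j\ge0}\overline{h_j^{0,q}(z)}\,\varphi_j^q(\xi)$, is $$\langle \xi|z,0,q\rangle=\left(\frac{\sqrt2\,\omega_q(\sqrt2\,\xi)}{e_q(z\bar z)}\right)^{1/2}\prod_{k\ge0}\frac{1}{1-\sqrt2\,\bar z\,\xi\,q^k(1-q)+\bar z^2q^{2k}(1-q)}.$$
   Context: Notation: $(a;q)_n=\prod_{k=0}^{n-1}(1-aq^k)$ for $n\in\{0,1,\dots\}\cup\{\infty\}$; $[k]_q!=(q;q)_k/(1-q)^k$; $e_q(u)=\sum_{k\ge0}\frac{u^k}{[k]_q!}$. Domain: $\mathbb{C}_q=\{z\in\mathbb{C}:(1-q)z\bar z<1\}$. Level $m=0$ coefficients: $h_j^{0,q}(z)=z^j/\sqrt{[j]_q!}$. Normalization factor: $\mathcal{N}_{0,q}(z\bar z)=\dfrac{1}{((1-q)z\bar z;q)_\infty}$. Continuous $q$-Hermite polynomials: $H_n(\cos\theta|q)=\sum_{k=0}^n\frac{(q;q)_n}{(q;q)_k(q;q)_{n-k}}e^{i(n-2k)\theta}$. Weight: $\omega_q(u)=\dfrac{(q;q)_\infty\sqrt{1-q}}{4\pi\sqrt{1-(1-q)u^2/4}}\prod_{k\ge0}\big(1+(2-u^2(1-q))q^k+q^{2k}\big)$. Interval: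 $\mathcal{I}_q=\left(-\frac{\sqrt2}{\sqrt{1-q}},\frac{\sqrt2}{\sqrt{1-q}}\right)$, and $\varphi_j^q(\xi)=\sqrt{\frac{\sqrt2\,\omega_q(\sqrt2\,\xi)}{(q;q)_j}}\,H_j\!\left(\sqrt{\tfrac{1-q}{2}}\,\xi\,\big|\,q\right)$ for $\xi\in\mathcal{I}_q$. *)

theory Defs
  imports "HOL-Analysis.Analysis"
begin

definition qpoch :: "real \<Rightarrow> real \<Rightarrow> nat \<Rightarrow> real" where
  "qpoch a q n = (\<Prod>k<n. 1 - a * q ^ k)"

definition qpoch_inf :: "real \<Rightarrow> real \<Rightarrow> real" where
  "qpoch_inf a q = (\<Prod>k. 1 - a * q ^ k)"

definition qfact :: "real \<Rightarrow> nat \<Rightarrow> real" where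
  "qfact q k = qpoch q q k / (1 - q) ^ k"

definition qexp :: "real \<Rightarrow> real \<Rightarrow> real" where
  "qexp q u = (\<Sum>k. u ^ k / qfact q k)"

text \<open>Throughout, the real number \<open>z \<cdot> cnj z\<close> is written as \<open>(cmod z)\<^sup>2\<close>.\<close>

definition Cq :: "real \<Rightarrow> complex set" where
  "Cq q = {z. (1 - q) * (cmod z)\<^sup>2 < 1}"

definition h0 :: "real \<Rightarrow> nat \<Rightarrow> complex \<Rightarrow> complex" where
  "h0 q j z = z ^ j / of_real (sqrt (qfact q j))"

definition N0 :: "real \<Rightarrow> real \<Rightarrow> real" where
  "N0 q u = 1 / qpoch_inf ((1 - q) * u) q"

text \<open>
  The defining formula is \<open>H\<^sub>n(cos \<theta> | q) = \<dots>\<close>. Its right-hand side depends only on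
  \<open>cos \<theta>\<close> (lemma \<open>qHermite_cos\<close> below), so any branch of the inverse cosine may be used.
\<close>

definition qHermite :: "real \<Rightarrow> nat \<Rightarrow> complex \<Rightarrow> complex" where
  "qHermite q n x =
     (\<Sum>k\<le>n. of_real (qpoch q q n / (qpoch q q k * qpoch q q (n - k))) *
        exp (\<i> * (of_nat n - 2 * of_nat k) * Arccos x))"

lemma qHermite_cos:
  fixes \<theta> :: complex
  shows "qHermite q n (cos \<theta>) =
     (\<Sum>k\<le>n. of_real (qpoch q q n / (qpoch q q k * qpoch q q (n - k))) *
        exp (\<i> * (of_nat n - 2 * of_nat k) * \<theta>))"
proof -
  define S where "S = (\<lambda>t::complex. \<Sum>k\<le>n.
      of_real (qpoch q q n / (qpoch q q k * qpoch q q (n - k))) *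
        exp (\<i> * (of_nat n - 2 * of_nat k) * t))"
  have even_S: "S (- t) = S t" for t
    unfolding S_def
    by (rule sum.reindex_bij_witness[of _ "\<lambda>k. n - k" "\<lambda>k. n - k"])
       (auto simp: of_nat_diff algebra_simps)
  have per_S: "S (t + of_int m * of_real (2 * pi)) = S t" for t m
  proof -
    have "exp (\<i> * (of_nat n - 2 * of_nat k) * (t + of_int m * of_real (2 * pi)))
        = exp (\<i> * (of_nat n - 2 * of_nat k) * t)" for k
      unfolding exp_eq
      by (rule exI[of _ "(int n - 2 * int k) * m"]) (simp add: algebra_simps)
    then show ?thesis unfolding S_def by simp
  qed
  have "cos (Arccos (cos \<theta>)) = cos \<theta>" by simp
  then obtain x where "x \<in> \<int>" and
    x: "Arccos (cos \<theta>) = \<theta> + of_real (2 * x * pi) \<or>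
        Arccos (cos \<theta>) = - \<theta> + of_real (2 * x * pi)"
    unfolding complex_cos_eq by blast
  moreover from \<open>x \<in> \<int>\<close> obtain m :: int where "x = of_int m"
    by (elim Ints_cases)
  ultimately have
    "Arccos (cos \<theta>) = \<theta> + of_int m * of_real (2 * pi) \<or>
     Arccos (cos \<theta>) = - \<theta> + of_int m * of_real (2 * pi)"
    by (simp add: mult_ac)
  then have "S (Arccos (cos \<theta>)) = S \<theta>"
    using per_S even_S by metis
  then show ?thesis unfolding S_def qHermite_def .
qed

definition qweight :: "real \<Rightarrow> real \<Rightarrow> real" where
  "qweight q u =
     qpoch_inf q q * sqrt (1 - q) / (4 * pi * sqrt (1 - (1 - q) * u\<^sup>2 / 4)) *
       (\<Prod>k. 1 + (2 - u\<^sup>2 * (1 - q)) * q ^ k + q ^ (2 * k))"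

definition Iq :: "real \<Rightarrow> real set" where
  "Iq q = {- (sqrt 2 / sqrt (1 - q)) <..< sqrt 2 / sqrt (1 - q)}"

definition phi :: "real \<Rightarrow> nat \<Rightarrow> real \<Rightarrow> complex" where
  "phi q j \<xi> = of_real (sqrt (sqrt 2 * qweight q (sqrt 2 * \<xi>) / qpoch q q j)) *
     qHermite q j (of_real (sqrt ((1 - q) / 2) * \<xi>))"

definition wave_function :: "real \<Rightarrow> complex \<Rightarrow> real \<Rightarrow> complex" where
  "wave_function q z \<xi> =
     of_real (N0 q ((cmod z)\<^sup>2) powr (- 1 / 2)) * (\<Sum>j. cnj (h0 q j z) * phi q j \<xi>)"

end

theory Submission
  imports Defs
begin

text \<open>
  With \<open>t = sqrt (1 - q) * cnj z\<close> and \<open>x = sqrt ((1 - q) / 2) * \<xi> = cos \<theta>\<close>, the square roots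
  of \<open>(q;q)\<^sub>j\<close> in the coefficient and in the wave function combine, and the series becomes
  \<open>sqrt (sqrt 2 * \<omega>)\<close> times the generating function \<open>\<Sum>j. H\<^sub>j(x|q) t\<^sup>j / (q;q)\<^sub>j\<close> of the
  continuous \<open>q\<close>-Hermite polynomials. The conditions \<open>z \<in> Cq q\<close> and \<open>\<xi> \<in> Iq q\<close> say exactly
  that \<open>|t| < 1\<close> and \<open>|x| < 1\<close>, so that \<open>\<theta>\<close> can be taken real.

  By its definition, \<open>H\<^sub>j(cos \<theta>|q) t\<^sup>j / (q;q)\<^sub>j\<close> is the \<open>j\<close>-th term of the Cauchy product of two
  Euler series \<open>\<Sum>k. s\<^sup>k / (q;q)\<^sub>k\<close>, at \<open>s = t exp (\<plusminus> \<i> \<theta>)\<close>. Euler's identity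
  (\<open>euler_has_prod\<close>) turns each of them into the product \<open>\<Prod>k. 1 / (1 - s q\<^sup>k)\<close>, and
  \<open>(1 - t exp (\<i> \<theta>) q\<^sup>k) (1 - t exp (- \<i> \<theta>) q\<^sup>k) = 1 - 2 t x q\<^sup>k + t\<^sup>2 q\<^bsup>2k\<^esup>\<close> is the factor
  in the claim (\<open>qHermite_generating_function\<close>). The same identity at the real point
  \<open>(1 - q) |z|\<^sup>2\<close> identifies the normalization factor with the \<open>q\<close>-exponential
  (\<open>qexp_eq_N0_pos\<close>). The square root of the weight splits off from
  the quotients whatever its sign, because \<open>sqrt\<close> is an odd multiplicative function on the reals.
\<close>

lemma qpoch_pos:
  assumes "0 < q" "q < 1"
  shows "qpoch q q n > 0"
  unfolding qpoch_def
proof (rule prod_pos)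
  fix k
  have "q * q ^ k < 1" using assms power_Suc_less_one[of q k] by simp
  then show "0 < 1 - q * q ^ k" by simp
qed

definition euler_coeff :: "real \<Rightarrow> nat \<Rightarrow> 'a :: real_normed_field" where
  "euler_coeff q k = of_real (1 / qpoch q q k)"

text \<open>
  The recursion behind the functional equation \<open>E(s) - E(s q) = s E(s)\<close> of the Euler series; it
  also gives the ratio of consecutive coefficients, whose limit is 1.
\<close>
lemma euler_coeff_Suc:
  assumes "0 < q" "q < 1"
  shows "(1 - of_real q ^ Suc k) * euler_coeff q (Suc k) = (euler_coeff q k :: 'a :: real_normed_field)"
proof -
  have "qpoch q q (Suc k) = qpoch q q k * (1 - q ^ Suc k)"
    by (simp add: qpoch_def)
  moreover have "qpoch q q (Suc k) > 0" using assms by (rule qpoch_pos)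
  ultimately have "(1 - q ^ Suc k) * (1 / qpoch q q (Suc k)) = 1 / qpoch q q k"
    by (auto simp del: power_Suc)
  then have "of_real ((1 - q ^ Suc k) * (1 / qpoch q q (Suc k))) = (of_real (1 / qpoch q q k) :: 'a)"
    by (rule arg_cong)
  then show ?thesis
    by (simp only: euler_coeff_def of_real_mult of_real_diff of_real_1 of_real_power)
qed

lemma summable_norm_euler:
  fixes t :: "'a :: {real_normed_field, banach}"
  assumes "0 < q" "q < 1" "norm t < 1"
  shows "summable (\<lambda>k. norm (euler_coeff q k * t ^ k))"
proof -
  obtain c where c: "norm t < c" "c < 1" using dense assms(3) by blast
  have "(\<lambda>k. norm t / (1 - q ^ Suc k)) \<longlonglongrightarrow> norm t / (1 - 0)"
    by (intro tendsto_intros LIMSEQ_Suc[OF LIMSEQ_power_zero]) (use assms in auto)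
  then have "\<forall>\<^sub>F k in sequentially. norm t / (1 - q ^ Suc k) < c"
    using c by (intro order_tendstoD) auto
  then obtain N where N: "\<And>k. k \<ge> N \<Longrightarrow> norm t / (1 - q ^ Suc k) < c"
    by (auto simp: eventually_sequentially)
  show ?thesis
  proof (rule summable_ratio_test[OF c(2)])
    fix k assume "k \<ge> N"
    have q1: "q ^ Suc k < 1" using assms by (intro power_Suc_less_one) auto
    have "norm ((1 - of_real q ^ Suc k) * euler_coeff q (Suc k) :: 'a) = norm (euler_coeff q k :: 'a)"
      using euler_coeff_Suc[OF assms(1,2), of k] by metis
    moreover have "norm (1 - of_real q ^ Suc k :: 'a) = 1 - q ^ Suc k"
    proof -
      have "norm (of_real (1 - q ^ Suc k) :: 'a) = 1 - q ^ Suc k"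
        using q1 by (simp only: norm_of_real)
      then show ?thesis by simp
    qed
    ultimately have e: "(1 - q ^ Suc k) * norm (euler_coeff q (Suc k) :: 'a) = norm (euler_coeff q k :: 'a)"
      by (simp only: norm_mult)
    have e': "norm (euler_coeff q (Suc k) :: 'a) = norm (euler_coeff q k :: 'a) / (1 - q ^ Suc k)"
      using q1 by (subst e[symmetric]) simp
    have "norm (euler_coeff q (Suc k) * t ^ Suc k)
        = (norm t / (1 - q ^ Suc k)) * norm (euler_coeff q k * t ^ k)"
      by (simp only: norm_mult norm_power e') simp
    also have "\<dots> \<le> c * norm (euler_coeff q k * t ^ k)"
      using N[OF \<open>k \<ge> N\<close>] by (intro mult_right_mono) auto
    finally show "norm (norm (euler_coeff q (Suc k) * t ^ Suc k))
        \<le> c * norm (norm (euler_coeff q k * t ^ k))" by simp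
  qed
qed

text \<open>
  Euler's identity. The functional equation \<open>E(s q) = (1 - s) E(s)\<close> iterates to
  \<open>E(t q\<^sup>n) = (\<Prod>k<n. 1 - t q\<^sup>k) E(t)\<close>, and the left-hand side tends to \<open>E(0) = 1\<close> by continuity
  of power series. This limit also shows \<open>E(t) \<noteq> 0\<close>, hence that the product converges to a nonzero
  value, as \<open>has_prod\<close> demands of a product without zero factors. The lemma is
  needed at complex points for the generating function and at a real one for the normalization.
\<close>
lemma euler_has_prod:
  fixes t :: "'a :: {real_normed_field, banach}"
  assumes q: "0 < q" "q < 1" and t: "norm t < 1"
  shows "(\<lambda>k. 1 / (1 - t * of_real q ^ k)) has_prod (\<Sum>k. euler_coeff q k * t ^ k)"
proof -
  define E where "E = (\<lambda>s::'a. \<Sum>k. euler_coeff q k * s ^ k)"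
  have sums: "(\<lambda>k. euler_coeff q k * s ^ k) sums E s" if "norm s < 1" for s :: 'a
    unfolding E_def
    by (rule summable_sums[OF summable_norm_cancel[OF summable_norm_euler[OF q that]]])
  have E0: "E 0 = 1"
    unfolding E_def powser_zero by (simp add: euler_coeff_def qpoch_def)
  have qt: "norm (t * of_real q ^ n) < 1" for n
  proof -
    have "norm (t * of_real q ^ n) \<le> norm t"
      using q by (simp add: norm_mult norm_power mult_left_le power_le_one)
    then show ?thesis using t by simp
  qed
  have shift: "E (s * of_real q) = (1 - s) * E s" if s: "norm s < 1" for s :: 'a
  proof -
    have sq: "norm (s * of_real q) < 1"
      using q s mult_strict_mono[of "norm s" 1 q 1] by (simp add: norm_mult)
    have "(\<lambda>k. euler_coeff q k * s ^ k - euler_coeff q k * (s * of_real q) ^ k)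
        sums (E s - E (s * of_real q))"
      by (intro sums_diff sums s sq)
    then have "(\<lambda>k. euler_coeff q (Suc k) * s ^ Suc k
          - euler_coeff q (Suc k) * (s * of_real q) ^ Suc k) sums (E s - E (s * of_real q))"
      by (subst sums_Suc_iff) simp
    also have "(\<lambda>k. euler_coeff q (Suc k) * s ^ Suc k
          - euler_coeff q (Suc k) * (s * of_real q) ^ Suc k)
        = (\<lambda>k. s * (euler_coeff q k * s ^ k))"
      by (rule ext, subst euler_coeff_Suc[OF q, symmetric])
        (simp add: power_mult_distrib algebra_simps)
    finally have "(\<lambda>k. s * (euler_coeff q k * s ^ k)) sums (E s - E (s * of_real q))" .
    moreover have "(\<lambda>k. s * (euler_coeff q k * s ^ k)) sums (s * E s)"
      by (intro sums_mult sums s)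
    ultimately have "E s - E (s * of_real q) = s * E s" by (rule sums_unique2)
    then show ?thesis by (simp add: algebra_simps)
  qed
  have partial: "(\<Prod>k<n. 1 - t * of_real q ^ k) * E t = E (t * of_real q ^ n)" for n
  proof (induction n)
    case (Suc n)
    then show ?case
      using shift[OF qt[of n]] by (simp add: mult_ac)
  qed simp
  have "isCont E 0"
  proof -
    have K: "norm (0 :: 'a) < norm (of_real (1 / 2) :: 'a)" "norm (of_real (1 / 2) :: 'a) < 1"
      by (simp_all only: norm_of_real) simp_all
    show ?thesis unfolding E_def
      by (rule isCont_powser[OF sums_summable[OF sums[OF K(2)]] K(1)])
  qed
  moreover have "(\<lambda>n. t * of_real q ^ n) \<longlonglongrightarrow> 0"
    by (intro tendsto_mult_right_zero LIMSEQ_power_zero) (use q in simp)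
  ultimately have lim: "(\<lambda>n. E (t * of_real q ^ n)) \<longlonglongrightarrow> 1"
    using isCont_tendsto_compose[of 0 E] E0 by metis
  have nz: "E t \<noteq> 0"
  proof
    assume "E t = 0"
    then have "E (t * of_real q ^ n) = 0" for n using partial[of n] by simp
    then have "(\<lambda>n. 0 :: 'a) \<longlonglongrightarrow> 1" using lim by simp
    then show False by (simp add: LIMSEQ_const_iff)
  qed
  have "(\<lambda>n. E t / E (t * of_real q ^ Suc n)) \<longlonglongrightarrow> E t / 1"
    by (intro tendsto_intros LIMSEQ_Suc[OF lim]) auto
  moreover have "E t / E (t * of_real q ^ Suc n) = (\<Prod>k\<le>n. 1 / (1 - t * of_real q ^ k))" for n
    using nz by (simp add: partial[of "Suc n", symmetric] prod_dividef lessThan_Suc_atMost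
        del: prod.lessThan_Suc power_Suc)
  ultimately have "(\<lambda>n. \<Prod>k\<le>n. 1 / (1 - t * of_real q ^ k)) \<longlonglongrightarrow> E t" by simp
  then show ?thesis
    using nz unfolding has_prod_def raw_has_prod_def E_def by simp
qed

text \<open>
  Since \<open>u\<^sup>k / [k]\<^sub>q! = ((1 - q) u)\<^sup>k / (q;q)\<^sub>k\<close>, the \<open>q\<close>-exponential is an Euler series.
  Positivity is what makes the exponent \<open>- 1 / 2\<close> of the normalization an inverse square root.
\<close>
lemma qexp_eq_N0_pos:
  assumes q: "0 < q" "q < 1" and u: "\<bar>(1 - q) * u\<bar> < 1"
  shows "qexp q u = N0 q u" and "N0 q u > 0"
proof -
  have eq: "qexp q u = (\<Sum>k. euler_coeff q k * ((1 - q) * u) ^ k)"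
    unfolding qexp_def qfact_def euler_coeff_def
    by (simp add: power_mult_distrib mult_ac)
  have hp: "(\<lambda>k. 1 / (1 - (1 - q) * u * q ^ k)) has_prod qexp q u"
    unfolding eq using euler_has_prod[OF q, of "(1 - q) * u"] u by simp
  have pos: "qexp q u > 0"
  proof (rule has_prod_pos[OF hp])
    fix k
    have "\<bar>(1 - q) * u\<bar> * q ^ k \<le> \<bar>(1 - q) * u\<bar>"
      using q by (intro mult_left_le power_le_one) auto
    moreover have "(1 - q) * u * q ^ k \<le> \<bar>(1 - q) * u\<bar> * q ^ k"
      using q by (intro mult_right_mono) auto
    ultimately have "(1 - q) * u * q ^ k < 1" using u by linarith
    then show "1 / (1 - (1 - q) * u * q ^ k) > 0" by simp
  qed
  from has_prod_inverse[OF hp]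
  have "(\<lambda>k. 1 - (1 - q) * u * q ^ k) has_prod inverse (qexp q u)" by simp
  then have "qpoch_inf ((1 - q) * u) q = inverse (qexp q u)"
    unfolding qpoch_inf_def by (rule has_prod_unique[symmetric])
  then show "qexp q u = N0 q u" by (simp add: N0_def divide_inverse)
  with pos show "N0 q u > 0" by simp
qed

text \<open>
  In the Cauchy product of the Euler series at \<open>a = t exp (- \<i> \<theta>)\<close> and \<open>b = t exp (\<i> \<theta>)\<close>, the
  term \<open>a\<^sup>i b\<^bsup>n-i\<^esup>\<close> carries the phase \<open>exp (\<i> (n - 2 i) \<theta>)\<close>, and the quotient of the coefficients
  by \<open>1 / (q;q)\<^sub>n\<close> is the \<open>q\<close>-binomial coefficient of \<open>H\<^sub>n\<close>.
\<close>
lemma qHermite_generating_function: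
  fixes t \<theta> :: complex
  assumes q: "0 < q" "q < 1"
    and t: "norm (t * exp (\<i> * \<theta>)) < 1" "norm (t * exp (- (\<i> * \<theta>))) < 1"
  obtains S where
    "(\<lambda>n. euler_coeff q n * t ^ n * qHermite q n (cos \<theta>)) sums S"
    "(\<lambda>k. 1 / (1 - 2 * t * cos \<theta> * of_real q ^ k + t\<^sup>2 * of_real q ^ (2 * k))) has_prod S"
proof -
  define a where "a = t * exp (- (\<i> * \<theta>))"
  define b where "b = t * exp (\<i> * \<theta>)"
  define A where "A = (\<Sum>k. euler_coeff q k * a ^ k)"
  define B where "B = (\<Sum>k. euler_coeff q k * b ^ k)"
  have na: "norm a < 1" and nb: "norm b < 1" using t by (simp_all add: a_def b_def)
  have coeff: "(\<Sum>i\<le>n. (euler_coeff q i * a ^ i) * (euler_coeff q (n - i) * b ^ (n - i)))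
      = euler_coeff q n * t ^ n * qHermite q n (cos \<theta>)" for n
    unfolding qHermite_cos sum_distrib_left
  proof (rule sum.cong[OF refl])
    fix i assume "i \<in> {..n}"
    then obtain m where n: "n = i + m" using le_Suc_ex by auto
    have "a ^ i * b ^ m = t ^ n * (exp (of_nat i * (- (\<i> * \<theta>))) * exp (of_nat m * (\<i> * \<theta>)))"
      unfolding exp_of_nat_mult by (simp add: a_def b_def n power_mult_distrib power_add)
    also have "\<dots> = t ^ n * exp (\<i> * (of_nat n - 2 * of_nat i) * \<theta>)"
      by (simp add: exp_add[symmetric] n algebra_simps)
    finally have ab: "a ^ i * b ^ m = t ^ n * exp (\<i> * (of_nat n - 2 * of_nat i) * \<theta>)" .
    have "qpoch q q n \<noteq> 0" using qpoch_pos[OF q, of n] by simp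
    then have "euler_coeff q i * euler_coeff q m
      = (euler_coeff q n * of_real (qpoch q q n / (qpoch q q i * qpoch q q m)) :: complex)"
      unfolding euler_coeff_def of_real_mult[symmetric] by simp
    then have "(euler_coeff q i * euler_coeff q m) * (a ^ i * b ^ m)
      = (euler_coeff q n * of_real (qpoch q q n / (qpoch q q i * qpoch q q m)))
          * (t ^ n * exp (\<i> * (of_nat n - 2 * of_nat i) * \<theta>))"
      by (simp only: ab)
    moreover have "n - i = m" by (simp add: n)
    ultimately show "(euler_coeff q i * a ^ i) * (euler_coeff q (n - i) * b ^ (n - i))
      = euler_coeff q n * t ^ n * (of_real (qpoch q q n / (qpoch q q i * qpoch q q (n - i)))
          * exp (\<i> * (of_nat n - 2 * of_nat i) * \<theta>))"
      by (simp only: mult_ac)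
  qed
  have s: "(\<lambda>n. euler_coeff q n * t ^ n * qHermite q n (cos \<theta>)) sums (A * B)"
    unfolding coeff[symmetric] A_def B_def
    by (intro Cauchy_product_sums summable_norm_euler q na nb)
  have "(\<lambda>k. 1 / (1 - a * of_real q ^ k) * (1 / (1 - b * of_real q ^ k))) has_prod (A * B)"
    unfolding A_def B_def by (intro has_prod_mult euler_has_prod q na nb)
  moreover have "1 / (1 - a * of_real q ^ k) * (1 / (1 - b * of_real q ^ k))
      = 1 / (1 - 2 * t * cos \<theta> * of_real q ^ k + t\<^sup>2 * of_real q ^ (2 * k))" for k
  proof -
    have "a + b = 2 * t * cos \<theta>"
      by (simp add: a_def b_def cos_exp_eq algebra_simps)
    moreover have "a * b = t\<^sup>2"
      by (simp add: a_def b_def power2_eq_square exp_minus)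
    moreover have "(1 - a * of_real q ^ k) * (1 - b * of_real q ^ k)
      = 1 - (a + b) * of_real q ^ k + (a * b) * of_real q ^ (2 * k)"
      unfolding mult_2 power_add by (simp add: algebra_simps)
    ultimately show ?thesis by simp
  qed
  ultimately have "(\<lambda>k. 1 / (1 - 2 * t * cos \<theta> * of_real q ^ k + t\<^sup>2 * of_real q ^ (2 * k)))
      has_prod (A * B)" by simp
  with s show ?thesis by (rule that)
qed

theorem mainTheorem2:
  fixes q :: real and z :: complex and \<xi> :: real
  assumes "0 < q" and "q < 1"
    and "z \<in> Cq q" and "\<xi> \<in> Iq q"
  shows "summable (\<lambda>j. cnj (h0 q j z) * phi q j \<xi>)
    \<and> convergent_prod (\<lambda>k. 1 / (1 - of_real (sqrt 2) * cnj z * of_real \<xi> * of_real q ^ k * of_real (1 - q)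
            + (cnj z)\<^sup>2 * of_real q ^ (2 * k) * of_real (1 - q)))
    \<and> wave_function q z \<xi> =
        of_real (sqrt (sqrt 2 * qweight q (sqrt 2 * \<xi>) / qexp q ((cmod z)\<^sup>2))) *
        (\<Prod>k. 1 / (1 - of_real (sqrt 2) * cnj z * of_real \<xi> * of_real q ^ k * of_real (1 - q)
            + (cnj z)\<^sup>2 * of_real q ^ (2 * k) * of_real (1 - q)))"
proof -
  define r where "r = sqrt (1 - q)"
  define t where "t = of_real r * cnj z"
  define x where "x = sqrt ((1 - q) / 2) * \<xi>"
  define \<theta> where "\<theta> = arccos x"
  define W where "W = sqrt 2 * qweight q (sqrt 2 * \<xi>)"
  define F where "F = (\<lambda>k. 1 / (1 - of_real (sqrt 2) * cnj z * of_real \<xi> * of_real q ^ k * of_real (1 - q)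
            + (cnj z)\<^sup>2 * of_real q ^ (2 * k) * of_real (1 - q)))"
  have r: "r > 0" "r\<^sup>2 = 1 - q" using assms by (simp_all add: r_def)
  have z: "(1 - q) * (cmod z)\<^sup>2 < 1" using assms(3) by (simp add: Cq_def)
  have xr: "x = r / sqrt 2 * \<xi>" by (simp add: x_def r_def real_sqrt_divide)
  have "\<bar>\<xi>\<bar> < sqrt 2 / r" using assms(4) by (auto simp: Iq_def r_def)
  then have "\<bar>x\<bar> < 1"
    using r by (simp add: xr abs_mult field_simps)
  then have cos: "cos (of_real \<theta>) = (of_real x :: complex)"
    by (simp add: \<theta>_def cos_of_real cos_arccos_abs)
  have nt: "norm t < 1"
  proof -
    have "(norm t)\<^sup>2 < 1"
      using z r by (simp add: t_def norm_mult power_mult_distrib)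
    then show ?thesis by (simp add: power_less_one_iff abs_square_less_1)
  qed
  obtain S where S:
    "(\<lambda>n. euler_coeff q n * t ^ n * qHermite q n (cos (of_real \<theta>))) sums S"
    "(\<lambda>k. 1 / (1 - 2 * t * cos (of_real \<theta>) * of_real q ^ k + t\<^sup>2 * of_real q ^ (2 * k))) has_prod S"
    by (rule qHermite_generating_function[OF assms(1,2), of t "of_real \<theta>"])
      (use nt in \<open>auto simp: norm_mult norm_exp_eq_Re\<close>)
  have summand: "cnj (h0 q j z) * phi q j \<xi>
      = of_real (sqrt W) * (euler_coeff q j * t ^ j * qHermite q j (cos (of_real \<theta>)))" for j
  proof -
    define p where "p = qpoch q q j"
    have p: "p > 0" unfolding p_def by (rule qpoch_pos[OF assms(1,2)])
    have "sqrt (qfact q j) = sqrt p / r ^ j"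
      by (simp add: qfact_def p_def r_def real_sqrt_divide real_sqrt_power)
    then have h: "cnj (h0 q j z) = t ^ j / of_real (sqrt p)"
      by (simp add: h0_def t_def power_mult_distrib)
    have ph: "phi q j \<xi> = of_real (sqrt W) / of_real (sqrt p) * qHermite q j (cos (of_real \<theta>))"
      unfolding phi_def cos x_def W_def p_def by (simp add: real_sqrt_divide)
    have "of_real (sqrt p) * of_real (sqrt p) = (of_real p :: complex)"
      unfolding of_real_mult[symmetric] using p by simp
    then have "euler_coeff q j = (1 / of_real (sqrt p) * (1 / of_real (sqrt p)) :: complex)"
      by (simp add: euler_coeff_def p_def)
    then show ?thesis unfolding h ph by simp
  qed
  have sums: "(\<lambda>j. cnj (h0 q j z) * phi q j \<xi>) sums (of_real (sqrt W) * S)"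
    unfolding summand by (intro sums_mult S(1))
  have "F k = 1 / (1 - 2 * t * cos (of_real \<theta>) * of_real q ^ k + t\<^sup>2 * of_real q ^ (2 * k))" for k
  proof -
    have "2 / sqrt 2 = sqrt 2" by (rule real_div_sqrt) simp
    moreover have "2 * r * x = (2 / sqrt 2) * \<xi> * r\<^sup>2" by (simp add: xr power2_eq_square)
    ultimately have "2 * r * x = sqrt 2 * \<xi> * r\<^sup>2" by (simp only:)
    then have "2 * r * x = sqrt 2 * \<xi> * (1 - q)" by (simp only: r(2))
    then have "of_real (2 * r * x) = (of_real (sqrt 2 * \<xi> * (1 - q)) :: complex)" by simp
    then have "2 * t * cos (of_real \<theta>) = of_real (sqrt 2) * cnj z * of_real \<xi> * of_real (1 - q)"
      unfolding cos t_def by (simp add: mult_ac)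
    moreover have "t\<^sup>2 = (cnj z)\<^sup>2 * of_real (1 - q)"
      unfolding r(2)[symmetric] t_def by (simp add: power_mult_distrib)
    ultimately show ?thesis unfolding F_def by (simp add: mult_ac)
  qed
  then have prod: "F has_prod S" using S(2) by presburger
  have N0: "qexp q ((cmod z)\<^sup>2) = N0 q ((cmod z)\<^sup>2)" "N0 q ((cmod z)\<^sup>2) > 0"
    using z assms by (auto intro!: qexp_eq_N0_pos)
  then have "N0 q ((cmod z)\<^sup>2) powr (- 1 / 2) = 1 / sqrt (qexp q ((cmod z)\<^sup>2))"
    using powr_minus_divide[of "N0 q ((cmod z)\<^sup>2)" "1 / 2"] by (simp add: powr_half_sqrt)
  then have "wave_function q z \<xi> = of_real (sqrt (W / qexp q ((cmod z)\<^sup>2))) * S"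
    unfolding wave_function_def sums_unique[OF sums, symmetric]
    by (simp add: real_sqrt_divide)
  then show ?thesis
    using sums prod unfolding F_def[symmetric] W_def
    by (simp add: sums_iff has_prod_iff)
qed

end
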